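(* Let $\Gamma\subset\mathbb{R}^s$ be a bounded set, triangulated into simplices $\Delta_1,\dots,\Delta_M$ with altogether $L$ vertices $Z^1,\dots,Z^L\in\Gamma$, let $\|\cdot\|$ be an arbitrary norm on $\mathbb{R}^s$, and let $m$ be the number such that the discrete Laplacian at a grid point is defined using $m+1$ grid points. Identify $f=(f_1,\dots,f_L)\in\mathbb{R}^L$ with the piecewise linear function $f\colon\Gamma\to\mathbb{R}$ with coefficients $f_k=f(Z^k)$, $k=1,\dots,L$. Let $$\mathcal{K} = \bigcap_{1\le j_l\le M}\left\{ f\in\mathbb{R}^L : \sum_{l=1}^m \left(f(t^l)-f(t^0)\right) \leq \left\|\sum_{l=1}^m (t^l-t^0)\right\| \text{ for any } \alpha^l\in\Delta^U_{s+1},\ l=0,1,\dots,m\right\},$$ where the intersection runs over all choices of indices $j_0,\dots,j_m\in\{1,\dots,M\}$ and $t^l := T_{j_l}\alpha^l$ is the point of $\Delta_{j_l}$ with barycentric coordinates $\alpha^l$. Then the set $\mathcal{K}$ can be written as $$\mathcal{K} = \left\{ f\in\mathbb{R}^L : f\colon\Gamma\to\mathbb{R} \text{ is concave and 1-Lipschitz continuous}\right\}.$$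
   Context: $\Delta^U_{s+1}=\{\alpha\in\mathbb{R}^{s+1}: \alpha_i\ge 0,\ \sum_i\alpha_i=1\}$ is the unit simplex. Each simplex $\Delta_j$ has $s+1$ vertices among $Z^1,\dots,Z^L$, and $T_j$ collects these vertices, so that $T_j\alpha$ denotes the convex combination of the vertices of $\Delta_j$ with coefficients $\alpha\in\Delta^U_{s+1}$. The piecewise linear function attached to $f\in\mathbb{R}^L$ is $f(z)=\sum_{k=1}^L f_k\Phi_k(z)$, where $\Phi_k\colon\Gamma\to\mathbb{R}$, $k=1,\dots,L$, are the piecewise linear finite element basis functions on the triangulation with $\Phi_k(Z^l)=1$ if $k=l$ and $0$ otherwise; $f(t^l)$ is the evaluation of this function at $t^l$. The discrete Laplacian of grid values $u^i\in\mathbb{R}^s$ at a grid point with index $i_0$ uses the values on the $m+1$ grid points with indices $i_0,\dots,i_m$: $(\Delta u)^{i_0}=\sum_{l=1}^m(u^{i_l}-u^{i_0})$ (for example, $m=4$ for the five-point stencil in two dimensions). Lipschitz continuity is with respect to the norm $\|\cdot\|$: $|f(y)-f(z)|\le\|y-z\|$ for all $y,z\in\Gamma$.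
   Formalization: The formal statement additionally assumes that Γ is convex (otherwise concavity on Γ is not defined in the usual sense and the claim fails) and that m ≥ 2 (for m = 1 the set K is just the set of 1-Lipschitz functions). *)

theory Defs
  imports "HOL-Analysis.Analysis"
begin

definition is_norm :: "('a::real_vector \<Rightarrow> real) \<Rightarrow> bool" where
  "is_norm N \<longleftrightarrow>
     (\<forall>x. 0 \<le> N x) \<and>
     (\<forall>x. N x = 0 \<longleftrightarrow> x = 0) \<and>
     (\<forall>c x. N (c *\<^sub>R x) = \<bar>c\<bar> * N x) \<and>
     (\<forall>x y. N (x + y) \<le> N x + N y)"

(* lipschitz_on is tied to the type-class metric; here the norm N is arbitrary. *)
definition one_lipschitz_on :: "('a::real_vector \<Rightarrow> real) \<Rightarrow> 'a set \<Rightarrow> ('a \<Rightarrow> real) \<Rightarrow> bool" where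
  "one_lipschitz_on N S g \<longleftrightarrow> (\<forall>y\<in>S. \<forall>z\<in>S. \<bar>g y - g z\<bar> \<le> N (y - z))"

definition unit_simplex :: "(real ^ 'n) set" where
  "unit_simplex = {\<alpha>. (\<forall>i. 0 \<le> \<alpha> $ i) \<and> (\<Sum>i\<in>UNIV. \<alpha> $ i) = 1}"

(* With s = CARD('s), the s + 1 vertices of a simplex are indexed by 's option, since
   CARD('s option) = s + 1. The columns of the s x (s + 1) matrix T j are the vertices of \<Delta> j
   in some order, so T j *v \<alpha> is the convex combination with coefficients \<alpha>. The simplices are
   indexed by 'j (M = CARD('j)) and the vertices of the triangulation by 'l (L = CARD('l)). *)
definition triangulated_by ::
  "(real ^ 's) set \<Rightarrow> ('j::finite \<Rightarrow> (real ^ 's) set) \<Rightarrow> ('l::finite \<Rightarrow> real ^ 's)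
    \<Rightarrow> ('j \<Rightarrow> real ^ ('s option) ^ 's) \<Rightarrow> bool" where
  "triangulated_by \<Gamma> \<Delta> Z T \<longleftrightarrow>
     triangulation (range \<Delta>) \<and> inj \<Delta> \<and>
     (\<forall>j. int CARD('s) simplex \<Delta> j) \<and>
     \<Gamma> = (\<Union>j. \<Delta> j) \<and>
     bij_betw Z UNIV {z. \<exists>j. z extreme_point_of \<Delta> j} \<and>
     (\<forall>j. bij_betw (\<lambda>i. column i (T j)) UNIV {z. z extreme_point_of \<Delta> j})"

(* Only the values of \<Phi> k on the union of the simplices are constrained; on that set the
   conditions determine \<Phi> k uniquely. *)
definition fe_basis ::
  "('j \<Rightarrow> (real ^ 's) set) \<Rightarrow> ('l \<Rightarrow> real ^ 's) \<Rightarrow> ('l \<Rightarrow> real ^ 's \<Rightarrow> real) \<Rightarrow> bool" where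
  "fe_basis \<Delta> Z \<Phi> \<longleftrightarrow>
     (\<forall>k. (\<forall>j. \<exists>h c. linear h \<and> (\<forall>z\<in>\<Delta> j. \<Phi> k z = h z + c)) \<and>
          (\<forall>l. \<Phi> k (Z l) = (if k = l then 1 else 0)))"

definition pl_fun :: "('l::finite \<Rightarrow> real ^ 's \<Rightarrow> real) \<Rightarrow> real ^ 'l \<Rightarrow> real ^ 's \<Rightarrow> real" where
  "pl_fun \<Phi> f z = (\<Sum>k\<in>UNIV. f $ k * \<Phi> k z)"

(* Choices of indices j_0, ..., j_m (and of \<alpha>^0, ..., \<alpha>^m) are functions on nat of which only
   the values at 0, ..., m matter. *)
definition constraint_set ::
  "nat \<Rightarrow> (real ^ 's \<Rightarrow> real) \<Rightarrow> ('j::finite \<Rightarrow> real ^ ('s option) ^ 's)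
    \<Rightarrow> ('l::finite \<Rightarrow> real ^ 's \<Rightarrow> real) \<Rightarrow> (real ^ 'l) set" where
  "constraint_set m N T \<Phi> =
     (\<Inter>j :: nat \<Rightarrow> 'j.
        {f. \<forall>\<alpha> :: nat \<Rightarrow> real ^ ('s option).
              (\<forall>l\<in>{0..m}. \<alpha> l \<in> unit_simplex) \<longrightarrow>
              (let t = (\<lambda>l. T (j l) *v \<alpha> l)
               in (\<Sum>l = 1..m. pl_fun \<Phi> f (t l) - pl_fun \<Phi> f (t 0))
                    \<le> N (\<Sum>l = 1..m. t l - t 0))})"

end

theory Submission
  imports Defs
begin

text \<open>
  The points \<open>T\<^sub>j \<alpha>\<close> with \<open>\<alpha>\<close> in the unit simplex are exactly the points of \<open>\<Delta>\<^sub>j\<close>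
  (\<open>matrix_image_unit_simplex\<close>), and the \<open>\<Delta>\<^sub>j\<close> cover \<open>\<Gamma>\<close>. As \<open>j\<^sub>0, \<dots>, j\<^sub>m\<close> and
  \<open>\<alpha>\<^sup>0, \<dots>, \<alpha>\<^sup>m\<close> vary independently, the constraints therefore say that
  \<open>\<Sum>l=1..m. (f t\<^sup>l - f t\<^sup>0) \<le> \<parallel>\<Sum>l=1..m. (t\<^sup>l - t\<^sup>0)\<parallel>\<close> for arbitrary points
  \<open>t\<^sup>0, \<dots>, t\<^sup>m\<close> of \<open>\<Gamma>\<close>. That this is equivalent to concavity together with 1-Lipschitz
  continuity is a fact about arbitrary real functions on a convex set
  (\<open>laplacian_bound_iff_concave_lipschitz\<close>).

  If \<open>f\<close> is concave and 1-Lipschitz, Jensen's inequality at the mean \<open>c\<close> of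
  \<open>t\<^sup>1, \<dots>, t\<^sup>m\<close> bounds the left-hand side by \<open>m (f c - f t\<^sup>0) \<le> m \<parallel>c - t\<^sup>0\<parallel>\<close>, which is the
  right-hand side.

  Conversely, two choices of points suffice. Taking \<open>t\<^sup>1 = \<dots> = t\<^sup>m\<close> gives \<open>m\<close> times the
  Lipschitz inequality. Taking \<open>t\<^sup>1 = x\<close>, \<open>t\<^sup>2 = y\<close> and all other points equal to the midpoint of
  \<open>x\<close> and \<open>y\<close> makes the right-hand side vanish and gives midpoint concavity. The Lipschitz
  inequality bounds \<open>f\<close> from below along segments, and midpoint concavity then improves to
  concavity (\<open>concave_on_if_midpoint_concave\<close>).
\<close>

section \<open>Midpoint concavity and concavity\<close>

text \<open>
  Along a segment, subtract from \<open>f\<close> the affine function with the same end values. The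
  difference \<open>g\<close> vanishes at both ends. Every parameter is the midpoint of one of the two ends
  and another parameter, so midpoint concavity bounds \<open>g\<close> from below by half of its infimum
  \<open>c\<close>. Hence \<open>c \<ge> c / 2\<close>, and as \<open>c\<close> is finite, \<open>c \<ge> 0\<close>.
\<close>

lemma concave_on_if_midpoint_concave:
  fixes f :: "'a::real_vector \<Rightarrow> real"
  assumes S: "convex S"
    and mid: "\<And>x y. x \<in> S \<Longrightarrow> y \<in> S \<Longrightarrow> f x + f y \<le> 2 * f (midpoint x y)"
    and bdd: "\<And>x y. x \<in> S \<Longrightarrow> y \<in> S \<Longrightarrow> bdd_below (f ` closed_segment x y)"
  shows "concave_on S f"
  unfolding concave_on_def
proof
  fix t :: real and x y
  assume t: "0 < t" "t < 1" and xy: "x \<in> S" "y \<in> S"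
  define p where "p u = (1 - u) *\<^sub>R x + u *\<^sub>R y" for u
  define g where "g u = f (p u) - ((1 - u) * f x + u * f y)" for u
  have pS: "p u \<in> S" if "u \<in> {0..1}" for u
    using that xy S by (auto simp: p_def convex_alt)
  have g_ends: "g 0 = 0" "g 1 = 0"
    by (auto simp: g_def p_def)
  have g_mid: "g u + g v \<le> 2 * g ((u + v) / 2)" if "u \<in> {0..1}" "v \<in> {0..1}" for u v
  proof -
    have "midpoint (p u) (p v) = p ((u + v) / 2)"
      by (simp add: midpoint_def p_def algebra_simps add_divide_distrib
          flip: scaleR_add_left)
    then show ?thesis
      using mid[OF pS pS, OF that] by (simp add: g_def field_simps)
  qed
  have g_bdd: "bdd_below (g ` {0..1})"
  proof -
    obtain b where b: "\<And>z. z \<in> closed_segment x y \<Longrightarrow> b \<le> f z"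
      using bdd[OF xy] by (auto simp: bdd_below_def)
    have "b - (\<bar>f x\<bar> + \<bar>f y\<bar>) \<le> g u" if u: "u \<in> {0..1}" for u
    proof -
      have "b \<le> f (p u)"
        using u by (intro b) (auto simp: closed_segment_def p_def)
      moreover have "s * a \<le> \<bar>a\<bar>" if "s \<in> {0..1}" for s a :: real
      proof -
        have "s * a \<le> s * \<bar>a\<bar>"
          using that by (intro mult_left_mono) auto
        also have "\<dots> \<le> \<bar>a\<bar>"
          using that by (intro mult_left_le_one_le) auto
        finally show ?thesis .
      qed
      from this[of "1 - u" "f x"] this[of u "f y"]
      have "(1 - u) * f x \<le> \<bar>f x\<bar>" "u * f y \<le> \<bar>f y\<bar>"
        using u by simp_all
      ultimately show ?thesis
        by (simp add: g_def)
    qed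
    then show ?thesis
      by (rule bdd_belowI2)
  qed
  define c where "c = (INF u\<in>{0..1}. g u)"
  have c_le: "c \<le> g u" if "u \<in> {0..1}" for u
    unfolding c_def using g_bdd that by (rule cINF_lower)
  have "c / 2 \<le> g u" if u: "u \<in> {0..1}" for u
  proof (cases "u \<le> 1 / 2")
    case True
    then show ?thesis
      using g_mid[of 0 "2 * u"] c_le[of "2 * u"] u g_ends by simp
  next
    case False
    then show ?thesis
      using g_mid[of "2 * u - 1" 1] c_le[of "2 * u - 1"] u g_ends by simp
  qed
  then have "c / 2 \<le> (INF u\<in>{0..1}. g u)"
    by (intro cINF_greatest) auto
  then have "c / 2 \<le> c"
    by (simp only: c_def)
  then have "0 \<le> g t"
    using c_le[of t] t by simp
  then show "- f ((1 - t) *\<^sub>R x + t *\<^sub>R y) \<le> (1 - t) * - f x + t * - f y"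
    by (simp add: g_def p_def)
qed (use S in simp)

section \<open>The Laplacian bound for functions on a convex set\<close>

text \<open>
  Jensen's inequality at the mean of \<open>t 1, \<dots>, t m\<close>: both sides of the bound are \<open>m\<close> times a
  quantity that compares the mean with \<open>t 0\<close>.
\<close>

lemma laplacian_bound_if_concave_lipschitz:
  fixes g :: "'a::real_vector \<Rightarrow> real" and m :: nat
  assumes conc: "concave_on S g" and lip: "one_lipschitz_on N S g" and N: "is_norm N"
    and m: "0 < m" and t: "\<And>l. l \<in> {0..m} \<Longrightarrow> t l \<in> S"
  shows "(\<Sum>l = 1..m. g (t l) - g (t 0)) \<le> N (\<Sum>l = 1..m. t l - t 0)"
proof -
  define c where "c = (\<Sum>l = 1..m. (1 / real m) *\<^sub>R t l)"
  have "c \<in> S"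
    unfolding c_def using conc m t
    by (intro convex_sum) (auto simp: concave_on_iff)
  have c: "(\<Sum>l = 1..m. t l - t 0) = real m *\<^sub>R (c - t 0)"
    using m by (simp add: c_def sum_subtractf scaleR_right_diff_distrib sum_constant_scaleR
        flip: scaleR_sum_right)
  have "(\<Sum>l = 1..m. (1 / real m) * g (t l)) \<le> g c"
    unfolding c_def using m t conc by (intro concave_on_sum) auto
  then have "(\<Sum>l = 1..m. g (t l)) \<le> real m * g c"
    using m by (simp add: field_simps flip: sum_distrib_left sum_divide_distrib)
  then have "(\<Sum>l = 1..m. g (t l) - g (t 0)) \<le> real m * (g c - g (t 0))"
    by (simp add: sum_subtractf algebra_simps)
  also have "\<dots> \<le> real m * N (c - t 0)"
    using lip \<open>c \<in> S\<close> t[of 0] by (intro mult_left_mono) (force simp: one_lipschitz_on_def)+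
  also have "\<dots> = N (\<Sum>l = 1..m. t l - t 0)"
    unfolding c using N by (simp add: is_norm_def)
  finally show ?thesis .
qed

lemma one_lipschitz_on_if_laplacian_bound:
  fixes g :: "'a::real_vector \<Rightarrow> real" and m :: nat
  assumes N: "is_norm N" and m: "0 < m"
    and bound: "\<And>t. (\<And>l. l \<in> {0..m} \<Longrightarrow> t l \<in> S) \<Longrightarrow>
      (\<Sum>l = 1..m. g (t l) - g (t 0)) \<le> N (\<Sum>l = 1..m. t l - t 0)"
  shows "one_lipschitz_on N S g"
proof -
  have le: "g y - g z \<le> N (y - z)" if "y \<in> S" "z \<in> S" for y z
  proof -
    define t where "t l = (if l = (0::nat) then z else y)" for l
    have "(\<Sum>l = 1..m. g (t l) - g (t 0)) = real m * (g y - g z)"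
      "(\<Sum>l = 1..m. t l - t 0) = real m *\<^sub>R (y - z)"
      by (simp_all add: t_def sum_constant_scaleR)
    moreover have "(\<Sum>l = 1..m. g (t l) - g (t 0)) \<le> N (\<Sum>l = 1..m. t l - t 0)"
      using that by (intro bound) (simp add: t_def)
    ultimately have "real m * (g y - g z) \<le> real m * N (y - z)"
      using N by (simp add: is_norm_def)
    then show ?thesis
      using m by simp
  qed
  have "N (z - y) = N (y - z)" for y z
    using N unfolding is_norm_def by (metis abs_minus_cancel abs_one minus_diff_eq mult_1 scaleR_minus1_left)
  then show ?thesis
    unfolding one_lipschitz_on_def by (smt (verit, best) le)
qed

text \<open>
  The right-hand side of the bound vanishes when \<open>t 0\<close> is the mean of the other points. Placing
  \<open>m - 2\<close> of them at \<open>t 0\<close> itself, where they contribute nothing to either side, leaves the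
  remaining two free as long as \<open>t 0\<close> is their midpoint.
\<close>

lemma midpoint_concave_if_laplacian_bound:
  fixes g :: "'a::real_vector \<Rightarrow> real" and m :: nat
  assumes N: "is_norm N" and m: "2 \<le> m" and S: "convex S"
    and bound: "\<And>t. (\<And>l. l \<in> {0..m} \<Longrightarrow> t l \<in> S) \<Longrightarrow>
      (\<Sum>l = 1..m. g (t l) - g (t 0)) \<le> N (\<Sum>l = 1..m. t l - t 0)"
    and xy: "x \<in> S" "y \<in> S"
  shows "g x + g y \<le> 2 * g (midpoint x y)"
proof -
  define z where "z = midpoint x y"
  have "z \<in> S"
    using S xy midpoint_in_closed_segment[of x y] unfolding z_def convex_contains_segment by blast
  define t where "t l = (if l = 1 then x else if l = 2 then y else z)" for l :: nat
  have sum2: "(\<Sum>l = 1..m. h (t l)) = h x + h y" if "h z = 0" for h :: "'a \<Rightarrow> 'b::comm_monoid_add"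
  proof -
    have "(\<Sum>l = 1..m. h (t l)) = (\<Sum>l \<in> {1, 2}. h (t l))"
      using m that by (intro sum.mono_neutral_right) (auto simp: t_def)
    then show ?thesis
      by (simp add: t_def)
  qed
  have t0: "t 0 = z"
    by (simp add: t_def)
  have "(\<Sum>l = 1..m. g (t l) - g z) = (g x - g z) + (g y - g z)"
    using sum2[of "\<lambda>w. g w - g z"] by simp
  moreover have "(\<Sum>l = 1..m. t l - z) = (x - z) + (y - z)"
    using sum2[of "\<lambda>w. w - z"] by simp
  moreover have "(x - z) + (y - z) = 0"
    using midpoint_eq_iff[of x y z] by (simp add: z_def algebra_simps)
  moreover have "N 0 = 0"
    using N by (simp add: is_norm_def)
  moreover have "(\<Sum>l = 1..m. g (t l) - g (t 0)) \<le> N (\<Sum>l = 1..m. t l - t 0)"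
    using xy \<open>z \<in> S\<close> by (intro bound) (simp add: t_def)
  ultimately show ?thesis
    by (simp add: t0 z_def)
qed

lemma bdd_below_segment_if_one_lipschitz_on:
  fixes g :: "'a::real_vector \<Rightarrow> real"
  assumes N: "is_norm N" and lip: "one_lipschitz_on N S g" and S: "convex S"
    and xy: "x \<in> S" "y \<in> S"
  shows "bdd_below (g ` closed_segment x y)"
proof (rule bdd_belowI2)
  fix z assume z: "z \<in> closed_segment x y"
  then obtain u where u: "0 \<le> u" "u \<le> 1" "z = (1 - u) *\<^sub>R x + u *\<^sub>R y"
    by (auto simp: closed_segment_def)
  have "z \<in> S"
    using z S xy by (auto simp: convex_contains_segment)
  have "x - z = u *\<^sub>R (x - y)"
    by (simp add: u algebra_simps)
  then have "N (x - z) = u * N (x - y)"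
    using N u by (simp add: is_norm_def)
  also have "\<dots> \<le> N (x - y)"
    using N u by (simp add: is_norm_def mult_left_le_one_le)
  finally have "\<bar>g x - g z\<bar> \<le> N (x - y)"
    using lip xy \<open>z \<in> S\<close> by (force simp: one_lipschitz_on_def)
  then show "g x - N (x - y) \<le> g z"
    by simp
qed

text \<open>
  Midpoint concavity alone does not imply concavity, so the order of the steps matters: the
  Lipschitz property comes first and supplies the lower bounds along segments.
\<close>

theorem laplacian_bound_iff_concave_lipschitz:
  fixes g :: "'a::real_vector \<Rightarrow> real" and m :: nat
  assumes N: "is_norm N" and m: "2 \<le> m" and S: "convex S"
  shows "(\<forall>t. (\<forall>l\<in>{0..m}. t l \<in> S) \<longrightarrow>
            (\<Sum>l = 1..m. g (t l) - g (t 0)) \<le> N (\<Sum>l = 1..m. t l - t 0))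
         \<longleftrightarrow> concave_on S g \<and> one_lipschitz_on N S g" (is "?bound \<longleftrightarrow> _")
proof
  assume ?bound
  then have bound: "(\<Sum>l = 1..m. g (t l) - g (t 0)) \<le> N (\<Sum>l = 1..m. t l - t 0)"
    if "\<And>l. l \<in> {0..m} \<Longrightarrow> t l \<in> S" for t
    using that by blast
  have lip: "one_lipschitz_on N S g"
    using N _ bound by (rule one_lipschitz_on_if_laplacian_bound) (use m in auto)
  moreover have "concave_on S g"
    using S midpoint_concave_if_laplacian_bound[OF N m S bound]
      bdd_below_segment_if_one_lipschitz_on[OF N lip S]
    by (rule concave_on_if_midpoint_concave)
  ultimately show "concave_on S g \<and> one_lipschitz_on N S g"
    by simp
next
  assume "concave_on S g \<and> one_lipschitz_on N S g"
  then show ?bound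
    using laplacian_bound_if_concave_lipschitz[of S g N m] N m by simp
qed

section \<open>Barycentric coordinates and the constraint set\<close>

lemma matrix_image_unit_simplex:
  fixes A :: "real ^ 'n ^ 's"
  assumes bij: "bij_betw (\<lambda>i. column i A) UNIV C"
  shows "(*v) A ` unit_simplex = convex hull C"
proof -
  have inj: "inj (\<lambda>i. column i A)" and C: "C = range (\<lambda>i. column i A)"
    using bij by (auto simp: bij_betw_def)
  have Av: "A *v \<alpha> = (\<Sum>i\<in>UNIV. \<alpha> $ i *\<^sub>R column i A)" for \<alpha>
    by (simp add: matrix_mult_sum scalar_mult_eq_scaleR)
  have "A *v \<alpha> \<in> convex hull C" if "\<alpha> \<in> unit_simplex" for \<alpha>
    unfolding Av using that
    by (intro convex_sum) (auto simp: unit_simplex_def C intro: hull_inc)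
  moreover have "z \<in> (*v) A ` unit_simplex" if z: "z \<in> convex hull C" for z
  proof -
    have "finite C"
      by (simp add: C)
    then obtain u where u: "\<forall>x\<in>C. 0 \<le> u x" "sum u C = 1" "(\<Sum>x\<in>C. u x *\<^sub>R x) = z"
      using z by (auto simp: convex_hull_finite)
    have "(\<chi> i. u (column i A)) \<in> unit_simplex"
      using u(1,2) unfolding C by (simp add: unit_simplex_def sum.reindex[OF inj] o_def)
    moreover have "A *v (\<chi> i. u (column i A)) = z"
      using u(3) unfolding C by (simp add: Av sum.reindex[OF inj] o_def)
    ultimately show ?thesis
      by blast
  qed
  ultimately show ?thesis
    by blast
qed

lemma simplex_eq_convex_hull_extreme_points:
  assumes "n simplex S"
  shows "S = convex hull {x. x extreme_point_of S}"
  using assms by (auto simp: simplex_def extreme_point_of_convex_hull_affine_independent)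

text \<open>
  Each \<open>t\<^sup>l\<close> has its own index \<open>j\<^sub>l\<close> and its own coefficients, so the constraints range over all
  tuples of points of the union, not only over tuples from a common simplex. This is what later
  gives inequalities between points of different simplices.
\<close>

lemma constraint_set_eq_laplacian_bound:
  fixes T :: "'j::finite \<Rightarrow> real ^ ('s option) ^ 's"
  assumes \<Gamma>: "\<Gamma> = (\<Union>j. (*v) (T j) ` unit_simplex)"
  shows "constraint_set m N T \<Phi> =
    {f. \<forall>t. (\<forall>l\<in>{0..m}. t l \<in> \<Gamma>) \<longrightarrow>
      (\<Sum>l = 1..m. pl_fun \<Phi> f (t l) - pl_fun \<Phi> f (t 0)) \<le> N (\<Sum>l = 1..m. t l - t 0)}"
    (is "_ = {f. \<forall>t. _ \<longrightarrow> ?bound f t}")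
proof (intro set_eqI iffI; clarify)
  fix f t
  assume f: "f \<in> constraint_set m N T \<Phi>" and t: "\<forall>l\<in>{0..m}. t l \<in> \<Gamma>"
  have "\<forall>l\<in>{0..m}. \<exists>j \<alpha>. \<alpha> \<in> unit_simplex \<and> t l = T j *v \<alpha>"
    using t unfolding \<Gamma> by blast
  then obtain j \<alpha> where j: "\<And>l. l \<in> {0..m} \<Longrightarrow> \<alpha> l \<in> unit_simplex \<and> t l = T (j l) *v \<alpha> l"
    by metis
  have "?bound f (\<lambda>l. T (j l) *v \<alpha> l)"
    using f j unfolding constraint_set_def Let_def by blast
  then show "?bound f t"
    using j by simp
next
  fix f
  assume f: "\<forall>t. (\<forall>l\<in>{0..m}. t l \<in> \<Gamma>) \<longrightarrow> ?bound f t"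
  have "?bound f (\<lambda>l. T (j l) *v \<alpha> l)" if "\<forall>l\<in>{0..m}. \<alpha> l \<in> unit_simplex" for j \<alpha>
  proof -
    have "\<forall>l\<in>{0..m}. T (j l) *v \<alpha> l \<in> \<Gamma>"
      using that unfolding \<Gamma> by blast
    with f show ?thesis
      by (rule spec[where x = "\<lambda>l. T (j l) *v \<alpha> l", THEN mp])
  qed
  then show "f \<in> constraint_set m N T \<Phi>"
    by (simp add: constraint_set_def Let_def)
qed

theorem proposition2:
  fixes \<Gamma> :: "(real ^ 's) set"
    and \<Delta> :: "'j::finite \<Rightarrow> (real ^ 's) set"
    and Z :: "'l::finite \<Rightarrow> real ^ 's"
    and T :: "'j \<Rightarrow> real ^ ('s option) ^ 's"
    and \<Phi> :: "'l \<Rightarrow> real ^ 's \<Rightarrow> real"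
    and N :: "real ^ 's \<Rightarrow> real"
    and m :: nat
  assumes "bounded \<Gamma>"
    and "convex \<Gamma>"
    and "triangulated_by \<Gamma> \<Delta> Z T"
    and "fe_basis \<Delta> Z \<Phi>"
    and "is_norm N"
    and "2 \<le> m"
  shows "constraint_set m N T \<Phi> =
         {f :: real ^ 'l. concave_on \<Gamma> (pl_fun \<Phi> f) \<and> one_lipschitz_on N \<Gamma> (pl_fun \<Phi> f)}"
proof -
  have "(*v) (T j) ` unit_simplex = \<Delta> j" for j
    using assms(3) matrix_image_unit_simplex simplex_eq_convex_hull_extreme_points
    unfolding triangulated_by_def by metis
  then have "\<Gamma> = (\<Union>j. (*v) (T j) ` unit_simplex)"
    using assms(3) by (simp add: triangulated_by_def)
  then have "constraint_set m N T \<Phi> = {f. \<forall>t. (\<forall>l\<in>{0..m}. t l \<in> \<Gamma>) \<longrightarrow>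
      (\<Sum>l = 1..m. pl_fun \<Phi> f (t l) - pl_fun \<Phi> f (t 0)) \<le> N (\<Sum>l = 1..m. t l - t 0)}"
    by (rule constraint_set_eq_laplacian_bound)
  then show ?thesis
    unfolding laplacian_bound_iff_concave_lipschitz[OF assms(5,6,2)] .
qed

end
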